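(* Let $T$ be a tree of order $n$. Then $$\frac{\sigma_1(T)}{\sigma_0(T)} \ge \frac{\sigma_1(S_n)}{\sigma_0(S_n)},$$ with equality if and only if $T = S_n$.
   Context: All graphs are finite and simple. For a graph $G$ and an integer $k\ge 0$, $\sigma_k(G)$ denotes the number of subsets $A\subseteq V(G)$ such that the subgraph of $G$ induced by $A$ has exactly $k$ edges. Thus $\sigma_0(G)$ is the number of independent vertex subsets of $G$ (including the empty set), and $\sigma_1(G)$ is the number of vertex subsets inducing exactly one edge. The order of a graph is its number of vertices. $S_n$ denotes the star with $n$ vertices (one centre joined to $n-1$ leaves; $S_1$ is a single vertex). Equality of graphs is understood up to isomorphism. *)

theory Defs
  imports Complex_Main "Graph_Theory.Graph_Theory"
begin

(* Finite simple graphs are finite symmetric digraphs without loops or parallel arcs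
   (locale graph). An undirected edge uv is then a pair of opposite arcs, which have
   the same image here. *)
definition edges :: "('a, 'b) pre_digraph \<Rightarrow> 'a set set" where
  "edges G = (\<lambda>e. {tail G e, head G e}) ` arcs G"

(* Digraph_Component.tree is not usable for symmetric digraphs: there every arc together with
   its reversal is a directed cycle, so that no graph with an edge is a tree in that sense.
   The cycles of a simple undirected graph are the directed cycles of length at least 3. *)
definition undirected_tree :: "('a, 'b) pre_digraph \<Rightarrow> bool" where
  "undirected_tree G \<longleftrightarrow>
     graph G \<and> Digraph_Component.connected G \<and> \<not> (\<exists>p. pre_digraph.cycle G p \<and> 3 \<le> length p)"

definition sigma :: "nat \<Rightarrow> ('a, 'b) pre_digraph \<Rightarrow> nat" where
  "sigma k G = card {A. A \<subseteq> verts G \<and> card (edges (G \<restriction> A)) = k}"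

(* Centre 0 and leaves 1, ..., n - 1; intended for n \<ge> 1. *)
definition star_graph :: "nat \<Rightarrow> (nat, nat \<times> nat) pre_digraph" where
  "star_graph n = with_proj \<lparr>pverts = {0..<n}, parcs = {0} \<times> {1..<n} \<union> {1..<n} \<times> {0}\<rparr>"

end

theory Submission
  imports Defs
begin

text \<open>
  Numerator and denominator are bounded separately, for a connected graph with \<open>n\<close> vertices.
  First, the two ends of an edge induce exactly that edge, so \<open>\<sigma>\<^sub>1\<close> is at least the
  number of edges, which is at least \<open>n - 1\<close> (\<open>edges_le_induced_by_one\<close>, \<open>card_edges_ge\<close>).
  Second, \<open>\<sigma>\<^sub>0 \<le> 2 ^ (n - 1) + 1\<close> (\<open>card_independent_le\<close>): group the vertex sets into the
  \<open>2 ^ (n - 1)\<close> pairs \<open>{A, V - A}\<close>. Both members of a pair are independent only if they are the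
  two colour classes of a proper 2-colouring, and a connected graph has at most one such pair.
  The star attains both bounds.

  If the ratios agree and \<open>n \<ge> 2\<close>, then both bounds are attained, as \<open>n - 1\<close> is positive. Then every pair contains
  an independent set, so no two edges are disjoint, and one pair consists of colour classes, so
  there is no triangle. Pairwise meeting edges without a triangle have a common end, and by
  connectedness this end is adjacent to all other vertices (\<open>star_if_card_independent\<close>).

  The argument only sees the family of edges as a family of two-element sets, so it is carried
  out for such families. The passage to digraphs rests on two facts: \<open>sigma\<close> depends only on the
  vertices and that family (\<open>sigma_eq_num_inducing\<close>), and a graph is isomorphic to the star graph
  exactly if its edges join one vertex to all the others (\<open>digraph_iso_star_graph_iff\<close>).
\<close>

section \<open>Vertex sets inducing a given number of edges\<close>

definition num_inducing :: "nat \<Rightarrow> 'a set \<Rightarrow> 'a set set \<Rightarrow> nat" where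
  "num_inducing k V E = card {A. A \<subseteq> V \<and> card {e \<in> E. e \<subseteq> A} = k}"

definition independent_sets :: "'a set \<Rightarrow> 'a set set \<Rightarrow> 'a set set" where
  "independent_sets V E = {A. A \<subseteq> V \<and> (\<forall>e\<in>E. \<not> e \<subseteq> A)}"

definition star_edges :: "'a \<Rightarrow> 'a set \<Rightarrow> 'a set set" where
  "star_edges c V = (\<lambda>x. {c, x}) ` (V - {c})"

lemma num_inducing_0:
  assumes "finite E"
  shows "num_inducing 0 V E = card (independent_sets V E)"
  unfolding num_inducing_def independent_sets_def using assms by (intro arg_cong[where f=card]) auto

section \<open>The star\<close>

lemma inj_on_insert_centre: "inj_on (\<lambda>x. {c, x}) (V - {c})"
  by (auto simp: inj_on_def doubleton_eq_iff)

lemma num_inducing_0_star: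
  assumes "finite V" "c \<in> V"
  shows "num_inducing 0 V (star_edges c V) = 2 ^ (card V - 1) + 1"
proof -
  have "independent_sets V (star_edges c V) = insert {c} (Pow (V - {c}))"
    using assms unfolding independent_sets_def star_edges_def by auto
  then have "card (independent_sets V (star_edges c V)) = 2 ^ (card V - 1) + 1"
    using assms by (simp add: card_insert_if card_Pow)
  then show ?thesis
    using assms by (simp add: num_inducing_0 star_edges_def)
qed

lemma card_star_edges_within:
  assumes "A \<subseteq> V"
  shows "card {e \<in> star_edges c V. e \<subseteq> A} = (if c \<in> A then card (A - {c}) else 0)"
proof (cases "c \<in> A")
  case True
  then have "{e \<in> star_edges c V. e \<subseteq> A} = (\<lambda>x. {c, x}) ` (A - {c})"
    using assms unfolding star_edges_def by auto
  then show ?thesis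
    using True card_image[OF inj_on_insert_centre, of c A] by (simp del: card_Diff_insert)
next
  case False
  then have "{e \<in> star_edges c V. e \<subseteq> A} = {}"
    unfolding star_edges_def by auto
  then show ?thesis
    using False by (simp only: card.empty if_False)
qed

lemma num_inducing_1_star:
  assumes "finite V" "c \<in> V"
  shows "num_inducing 1 V (star_edges c V) = card V - 1"
proof -
  have "A \<subseteq> V \<and> card {e \<in> star_edges c V. e \<subseteq> A} = 1 \<longleftrightarrow> A \<in> star_edges c V" for A
  proof
    assume A: "A \<subseteq> V \<and> card {e \<in> star_edges c V. e \<subseteq> A} = 1"
    then have "c \<in> A" "card (A - {c}) = 1"
      using card_star_edges_within[of A V c] by (metis zero_neq_one)+
    from this(2) obtain x where "A - {c} = {x}"
      by (rule card_1_singletonE)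
    then have "A = {c, x}" "x \<in> V - {c}"
      using \<open>c \<in> A\<close> A by auto
    then show "A \<in> star_edges c V"
      unfolding star_edges_def by blast
  next
    assume "A \<in> star_edges c V"
    then obtain x where "A = {c, x}" "x \<in> V" "x \<noteq> c"
      unfolding star_edges_def by auto
    moreover from this have "A - {c} = {x}"
      by auto
    ultimately show "A \<subseteq> V \<and> card {e \<in> star_edges c V. e \<subseteq> A} = 1"
      using assms card_star_edges_within[of A V c] by simp
  qed
  then have "num_inducing 1 V (star_edges c V) = card (star_edges c V)"
    unfolding num_inducing_def by simp
  then show ?thesis
    using assms card_image[OF inj_on_insert_centre, of c V] by (simp add: star_edges_def)
qed

section \<open>Connected graphs as families of edges\<close>

text \<open>
  Connectedness is stated by cuts, since this is the form in which the proofs below use it.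
\<close>

locale connected_edge_family =
  fixes V :: "'a set" and E :: "'a set set"
  assumes finite_vertices: "finite V"
    and nonempty: "V \<noteq> {}"
    and edge_ends: "e \<in> E \<Longrightarrow> \<exists>u\<in>V. \<exists>v\<in>V. u \<noteq> v \<and> e = {u, v}"
    and crossing_edge: "S \<subseteq> V \<Longrightarrow> S \<noteq> {} \<Longrightarrow> S \<noteq> V \<Longrightarrow> \<exists>x\<in>S. \<exists>y\<in>V - S. {x, y} \<in> E"
begin

lemma edge_subset: "e \<in> E \<Longrightarrow> e \<subseteq> V"
  by (drule edge_ends) auto

lemma edge_subset_edge: "e \<in> E \<Longrightarrow> f \<in> E \<Longrightarrow> e \<subseteq> f \<Longrightarrow> e = f"
  by (drule edge_ends, drule edge_ends) auto

lemma finite_edges: "finite E"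
  using edge_subset by (intro finite_subset[of E "Pow V"]) (auto simp: finite_vertices)

lemma edges_le_induced_by_one: "card E \<le> num_inducing 1 V E"
proof -
  have "{e \<in> E. e \<subseteq> f} = {f}" if "f \<in> E" for f
    using that edge_subset_edge by blast
  then have "E \<subseteq> {A. A \<subseteq> V \<and> card {e \<in> E. e \<subseteq> A} = 1}"
    using edge_subset by auto
  then show ?thesis
    unfolding num_inducing_def by (rule card_mono[rotated]) (simp add: finite_vertices)
qed

text \<open>
  A vertex set grown from a single vertex along crossing edges gains an edge with every new vertex.
\<close>

lemma card_edges_ge: "card V - 1 \<le> card E"
proof -
  have grow: "\<exists>S\<subseteq>V. card S = Suc k \<and> k \<le> card {e \<in> E. e \<subseteq> S}" if "k < card V" for k
    using that
  proof (induction k)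
    case 0
    from nonempty obtain v where "v \<in> V" by blast
    then show ?case by (intro exI[of _ "{v}"]) simp
  next
    case (Suc k)
    then obtain S where S: "S \<subseteq> V" "card S = Suc k" "k \<le> card {e \<in> E. e \<subseteq> S}"
      by auto
    then have "S \<noteq> {}" "S \<noteq> V" "finite S"
      using Suc.prems finite_vertices by (auto intro: finite_subset)
    then obtain x y where xy: "x \<in> S" "y \<in> V - S" "{x, y} \<in> E"
      using crossing_edge S(1) by blast
    have "insert {x, y} {e \<in> E. e \<subseteq> S} \<subseteq> {e \<in> E. e \<subseteq> insert y S}"
      using xy by auto
    then have "card (insert {x, y} {e \<in> E. e \<subseteq> S}) \<le> card {e \<in> E. e \<subseteq> insert y S}"
      by (rule card_mono[rotated]) (simp add: finite_edges)
    moreover have "card (insert {x, y} {e \<in> E. e \<subseteq> S}) = Suc (card {e \<in> E. e \<subseteq> S})"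
      using xy by (subst card_insert_disjoint) (auto simp: finite_edges)
    ultimately have "Suc k \<le> card {e \<in> E. e \<subseteq> insert y S}"
      using S(3) by linarith
    moreover have "card (insert y S) = Suc (Suc k)" "insert y S \<subseteq> V"
      using S xy \<open>finite S\<close> by auto
    ultimately show ?case by blast
  qed
  have "card V > 0"
    using nonempty finite_vertices by (simp add: card_gt_0_iff)
  then obtain S where "card V - 1 \<le> card {e \<in> E. e \<subseteq> S}"
    using grow[of "card V - 1"] by auto
  also have "\<dots> \<le> card E"
    by (rule card_mono) (auto simp: finite_edges)
  finally show ?thesis .
qed

section \<open>Counting independent sets\<close>

text \<open>The colour classes of the proper 2-colourings.\<close>

definition colour_classes :: "'a set set" where
  "colour_classes = {A. A \<in> independent_sets V E \<and> V - A \<in> independent_sets V E}"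

text \<open>
  Every edge has exactly one end in each colour class. So the set of vertices on which two classes
  agree is joined by no edge to the rest, and by connectedness it is empty or everything.
\<close>

lemma colour_class_cases:
  assumes A: "A \<in> colour_classes" and B: "B \<in> colour_classes"
  shows "B = A \<or> B = V - A"
proof -
  define S where "S = {x \<in> V. x \<in> A \<longleftrightarrow> x \<in> B}"
  have sub: "A \<subseteq> V" "B \<subseteq> V"
    using A B by (auto simp: colour_classes_def independent_sets_def)
  have split: "x \<in> C \<longleftrightarrow> y \<notin> C"
    if "C \<in> colour_classes" "x \<in> V" "y \<in> V" "{x, y} \<in> E" for x y C
  proof -
    have "\<not> {x, y} \<subseteq> C" "\<not> {x, y} \<subseteq> V - C"
      using that(1,4) unfolding colour_classes_def independent_sets_def by blast+
    then show ?thesis using that(2,3) by blast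
  qed
  have "S = {} \<or> S = V"
  proof (rule ccontr)
    assume "\<not> (S = {} \<or> S = V)"
    moreover have "S \<subseteq> V" unfolding S_def by blast
    ultimately obtain x y where xy: "x \<in> S" "y \<in> V - S" "{x, y} \<in> E"
      using crossing_edge by blast
    then show False
      using split[OF A, of x y] split[OF B, of x y] unfolding S_def by blast
  qed
  then show ?thesis
    using sub unfolding S_def by blast
qed

lemma card_colour_classes_le: "card colour_classes \<le> 2"
proof (cases "colour_classes = {}")
  case False
  then obtain A where "A \<in> colour_classes" by blast
  then have "colour_classes \<subseteq> {A, V - A}"
    using colour_class_cases by blast
  then have "card colour_classes \<le> card {A, V - A}"
    by (rule card_mono[rotated]) simp
  also have "\<dots> \<le> 2"
    by (simp add: card_insert_if)
  finally show ?thesis .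
qed simp

definition co_independent_sets :: "'a set set" where
  "co_independent_sets = {A. A \<subseteq> V \<and> V - A \<in> independent_sets V E}"

lemma card_co_independent_sets:
  "card co_independent_sets = card (independent_sets V E)"
proof (rule bij_betw_same_card)
  show "bij_betw (\<lambda>A. V - A) co_independent_sets (independent_sets V E)"
    by (rule bij_betw_byWitness[where f' = "\<lambda>A. V - A"])
      (auto simp: co_independent_sets_def independent_sets_def double_diff)
qed

text \<open>
  Inclusion and exclusion for the independent sets and their complements: this is the pairing of
  \<open>A\<close> with \<open>V - A\<close>, counted twice.
\<close>

lemma double_card_independent:
  "2 * card (independent_sets V E)
     = card (independent_sets V E \<union> co_independent_sets) + card colour_classes"
proof -
  have "independent_sets V E \<inter> co_independent_sets = colour_classes"
    unfolding colour_classes_def co_independent_sets_def independent_sets_def by auto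
  moreover have "finite (independent_sets V E)" "finite co_independent_sets"
    unfolding co_independent_sets_def independent_sets_def by (simp_all add: finite_vertices)
  ultimately show ?thesis
    using card_Un_Int[of "independent_sets V E" co_independent_sets] card_co_independent_sets
    by simp
qed

lemma independent_Un_co_independent_subset:
  "independent_sets V E \<union> co_independent_sets \<subseteq> Pow V"
  unfolding co_independent_sets_def independent_sets_def by auto

lemma card_independent_Un_co_independent_le:
  "card (independent_sets V E \<union> co_independent_sets) \<le> 2 ^ card V"
  using card_mono[OF _ independent_Un_co_independent_subset] finite_vertices
  by (simp add: card_Pow)

lemma two_power_card: "2 ^ card V = 2 * (2::nat) ^ (card V - 1)"
  using nonempty finite_vertices by (simp add: card_gt_0_iff flip: power_Suc)

lemma card_independent_le: "card (independent_sets V E) \<le> 2 ^ (card V - 1) + 1"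
  using double_card_independent card_independent_Un_co_independent_le card_colour_classes_le
    two_power_card by linarith

text \<open>
  If the bound is attained, then every vertex set or its complement is independent, and a colour
  class exists. Taking one edge as the vertex set shows that the edges meet pairwise; the colour
  class excludes triangles.
\<close>

lemma star_if_card_independent:
  assumes extremal: "card (independent_sets V E) = 2 ^ (card V - 1) + 1"
  shows "\<exists>c\<in>V. E = star_edges c V"
proof -
  have "card (independent_sets V E \<union> co_independent_sets) = card (Pow V)"
    and two: "card colour_classes = 2"
    using extremal double_card_independent card_independent_Un_co_independent_le
      card_colour_classes_le two_power_card finite_vertices by (simp_all add: card_Pow)
  then have all: "independent_sets V E \<union> co_independent_sets = Pow V"
    using independent_Un_co_independent_subset finite_vertices by (intro card_subset_eq) auto
  have meet: "e \<inter> f \<noteq> {}" if "e \<in> E" "f \<in> E" for e f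
  proof
    assume disjoint: "e \<inter> f = {}"
    have "e \<subseteq> V" "f \<subseteq> V"
      using that edge_subset by blast+
    then have "\<not> e \<subseteq> e \<or> \<not> f \<subseteq> V - e"
      using all that unfolding independent_sets_def co_independent_sets_def by blast
    then show False
      using disjoint \<open>f \<subseteq> V\<close> by blast
  qed
  from two obtain A where "A \<in> colour_classes"
    by (metis card.empty ex_in_conv zero_neq_numeral)
  then have A: "\<not> e \<subseteq> A" "\<not> e \<subseteq> V - A" if "e \<in> E" for e
    using that unfolding colour_classes_def independent_sets_def by auto
  have no_triangle: False if "{u, v} \<in> E" "{v, w} \<in> E" "{u, w} \<in> E" for u v w
  proof -
    have "u \<in> V" "v \<in> V" "w \<in> V"
      using that edge_subset by blast+
    then show False
      using A[OF that(1)] A[OF that(2)] A[OF that(3)] by blast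
  qed
  have "\<exists>c\<in>V. \<forall>e\<in>E. c \<in> e"
  proof (cases "E = {}")
    case True
    then show ?thesis using nonempty by blast
  next
    case False
    then obtain u v where uv: "u \<in> V" "v \<in> V" "{u, v} \<in> E"
      using edge_ends by blast
    show ?thesis
    proof (rule ccontr)
      assume none: "\<not> ?thesis"
      then obtain e f where ef: "e \<in> E" "u \<notin> e" "f \<in> E" "v \<notin> f"
        using uv by blast
      \<comment> \<open>Both \<open>e\<close> and \<open>f\<close> meet \<open>{u, v}\<close>, so \<open>e\<close> contains \<open>v\<close> and \<open>f\<close> contains \<open>u\<close>; their common
        vertex is the third corner of a triangle.\<close>
      obtain w where w: "w \<in> e" "w \<in> f"
        using meet[OF ef(1,3)] by blast
      have "v \<in> e" "u \<in> f"
        using meet[OF ef(1) uv(3)] meet[OF ef(3) uv(3)] ef by auto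
      then have "e = {v, w}" "f = {u, w}"
        using w ef edge_ends[OF ef(1)] edge_ends[OF ef(3)] by auto
      then show False
        using no_triangle uv ef by blast
    qed
  qed
  then obtain c where c: "c \<in> V" "\<And>e. e \<in> E \<Longrightarrow> c \<in> e"
    by blast
  have "E = star_edges c V"
  proof
    show "E \<subseteq> star_edges c V"
    proof
      fix e assume e: "e \<in> E"
      then obtain u v where "u \<in> V" "v \<in> V" "u \<noteq> v" "e = {u, v}"
        using edge_ends by blast
      then show "e \<in> star_edges c V"
        using c(2)[OF e] unfolding star_edges_def by (auto simp: insert_commute)
    qed
    show "star_edges c V \<subseteq> E"
    proof
      fix e assume "e \<in> star_edges c V"
      then obtain x where x: "x \<in> V" "x \<noteq> c" "e = {c, x}"
        unfolding star_edges_def by auto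
      \<comment> \<open>An edge leaves \<open>{x}\<close>, and it contains \<open>c\<close>.\<close>
      then obtain y where "{x, y} \<in> E"
        using crossing_edge[of "{x}"] c(1) by blast
      moreover from this have "y = c"
        using c(2) x(2) by blast
      ultimately show "e \<in> E"
        using x(3) by (simp add: insert_commute)
    qed
  qed
  then show ?thesis using c(1) by blast
qed

lemma card_independent_pos: "card (independent_sets V E) > 0"
proof -
  have "{} \<in> independent_sets V E"
    using edge_ends unfolding independent_sets_def by fastforce
  moreover have "finite (independent_sets V E)"
    unfolding independent_sets_def by (simp add: finite_vertices)
  ultimately show ?thesis
    by (auto simp: card_gt_0_iff)
qed

text \<open>
  Here \<open>card V - 1\<close> and \<open>2 ^ (card V - 1) + 1\<close> are the two counts for a star.
\<close>

theorem induced_ratio_ge_star: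
  "real (card V - 1) / real (2 ^ (card V - 1) + 1)
     \<le> real (num_inducing 1 V E) / real (num_inducing 0 V E)"
proof (rule frac_le)
  show "real (card V - 1) \<le> real (num_inducing 1 V E)"
    using card_edges_ge edges_le_induced_by_one by linarith
  show "0 < real (num_inducing 0 V E)"
    using card_independent_pos by (simp add: num_inducing_0 finite_edges)
  show "real (num_inducing 0 V E) \<le> real (2 ^ (card V - 1) + 1)"
    using card_independent_le by (simp only: num_inducing_0 finite_edges of_nat_le_iff)
qed simp

theorem induced_ratio_eq_star_iff:
  "real (num_inducing 1 V E) / real (num_inducing 0 V E)
     = real (card V - 1) / real (2 ^ (card V - 1) + 1)
   \<longleftrightarrow> (\<exists>c\<in>V. E = star_edges c V)" (is "?ratio \<longleftrightarrow> ?star")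
proof
  assume ?star
  then obtain c where "c \<in> V" "E = star_edges c V"
    by blast
  then show ?ratio
    using num_inducing_0_star[OF finite_vertices] num_inducing_1_star[OF finite_vertices] by simp
next
  assume ratio: ?ratio
  show ?star
  \<comment> \<open>For a single vertex both numerators vanish and the ratios say nothing about \<open>\<sigma>\<^sub>0\<close>.\<close>
  proof (cases "card V = 1")
    case True
    then obtain c where "V = {c}"
      by (auto simp: card_1_singleton_iff)
    then have "E = star_edges c V"
      using edge_ends unfolding star_edges_def by auto
    then show ?thesis using \<open>V = {c}\<close> by blast
  next
    case False
    define s where "s = card (independent_sets V E)"
    have pos: "card V - 1 > 0"
      using False nonempty finite_vertices
      by (metis One_nat_def card_0_eq diff_is_0_eq gr0I le_Suc_eq le_zero_eq)
    define d :: nat where "d = 2 ^ (card V - 1) + 1"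
    have "real (num_inducing 1 V E) / real s = real (card V - 1) / real d"
      using ratio by (simp only: s_def d_def num_inducing_0[OF finite_edges])
    moreover have "s \<noteq> 0" "d \<noteq> 0"
      using card_independent_pos unfolding s_def d_def by simp_all
    ultimately have "real (num_inducing 1 V E) * real d = real (card V - 1) * real s"
      by (simp only: frac_eq_eq of_nat_eq_0_iff not_False_eq_True)
    then have "num_inducing 1 V E * d = (card V - 1) * s"
      by (simp only: of_nat_eq_iff flip: of_nat_mult)
    moreover have "card V - 1 \<le> num_inducing 1 V E"
      using card_edges_ge edges_le_induced_by_one by linarith
    ultimately have "(card V - 1) * d \<le> (card V - 1) * s"
      by (metis mult_le_mono1)
    then have "d \<le> s"
      using pos by (simp only: mult_le_cancel1)
    then show ?thesis
      using card_independent_le star_if_card_independent unfolding s_def d_def by simp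
  qed
qed

end

section \<open>Passage to symmetric digraphs\<close>

lemma edges_induce_subgraph: "edges (G \<restriction> A) = {e \<in> edges G. e \<subseteq> A}"
  unfolding edges_def by auto

lemma sigma_eq_num_inducing: "sigma k G = num_inducing k (verts G) (edges G)"
  unfolding sigma_def num_inducing_def edges_induce_subgraph ..

lemma edge_iff_arcs_ends:
  assumes "symmetric G"
  shows "{u, v} \<in> edges G \<longleftrightarrow> (u, v) \<in> arcs_ends G"
proof
  assume "{u, v} \<in> edges G"
  then have "(u, v) \<in> arcs_ends G \<or> (v, u) \<in> arcs_ends G"
    unfolding edges_def arcs_ends_conv by (auto simp: doubleton_eq_iff)
  then show "(u, v) \<in> arcs_ends G"
    using arcs_ends_symmetric[OF assms] by blast
next
  assume "(u, v) \<in> arcs_ends G"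
  then show "{u, v} \<in> edges G"
    unfolding edges_def arcs_ends_conv by auto
qed

lemma connected_edge_family_edges:
  assumes "graph G" "Digraph_Component.connected G"
  shows "connected_edge_family (verts G) (edges G)"
proof -
  interpret graph G by fact
  show ?thesis
  proof
    show "finite (verts G)" by simp
    show "verts G \<noteq> {}"
      using assms(2) by (auto simp: connected_def strongly_connected_def mk_symmetric_def)
    show "\<exists>u\<in>verts G. \<exists>v\<in>verts G. u \<noteq> v \<and> e = {u, v}" if "e \<in> edges G" for e
      using that no_loops unfolding edges_def by fastforce
    fix S assume S: "S \<subseteq> verts G" "S \<noteq> {}" "S \<noteq> verts G"
    then obtain x y where xy: "x \<in> S" "y \<in> verts G - S"
      by blast
    then have "x \<rightarrow>\<^sup>*\<^bsub>G\<^esub> y"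
      using assms(2) S(1) reachable_mk_symmetric_eq[OF sym_arcs]
      unfolding connected_def strongly_connected_def by (auto simp: mk_symmetric_def)
    \<comment> \<open>A walk from \<open>x\<close> in \<open>S\<close> to a vertex outside has a first arc that leaves \<open>S\<close>.\<close>
    moreover have "\<exists>x\<in>S. \<exists>y\<in>verts G - S. (x, y) \<in> arcs_ends G"
      if "x \<rightarrow>\<^sup>*\<^bsub>G\<^esub> z" "z \<notin> S" for z
      using that
    proof (induction rule: reachable_induct)
      case base
      then show ?case using xy by simp
    next
      case (step a b)
      then show ?case using adj_in_verts[OF step(2)] by blast
    qed
    ultimately show "\<exists>x\<in>S. \<exists>y\<in>verts G - S. {x, y} \<in> edges G"
      using xy by (simp add: edge_iff_arcs_ends[OF sym_arcs])
  qed
qed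

lemma edges_star_graph:
  assumes "n \<ge> 1"
  shows "edges (star_graph n) = star_edges 0 (verts (star_graph n))"
proof -
  have "{0..<n} - {0} = {1..<n}" by auto
  then have "star_edges 0 (verts (star_graph n)) = (\<lambda>x. {0, x}) ` {1..<n}"
    by (simp add: star_edges_def star_graph_def)
  moreover have "edges (star_graph n) = (\<lambda>(u, v). {u, v}) ` ({0} \<times> {1..<n} \<union> {1..<n} \<times> {0})"
    by (simp add: edges_def star_graph_def split_def)
  moreover have "\<dots> = (\<lambda>x. {0, x}) ` {1..<n}"
    by (auto simp: image_Un insert_commute)
  ultimately show ?thesis by simp
qed

lemma edges_app_iso:
  assumes "pre_digraph.digraph_isomorphism G hom"
  shows "edges (app_iso hom G) = (`) (iso_verts hom) ` edges G"
  using assms unfolding edges_def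
  by (auto simp: pre_digraph.digraph_isomorphism_def image_image intro!: image_cong)

lemma image_star_edges:
  assumes "inj_on h V" "c \<in> V"
  shows "(`) h ` star_edges c V = star_edges (h c) (h ` V)"
proof -
  have "h ` V - {h c} = h ` (V - {c})"
    using assms by (auto simp: inj_on_def)
  then show ?thesis
    unfolding star_edges_def by (simp add: image_image)
qed

lemma star_edges_if_digraph_iso:
  assumes "graph G" "digraph_iso G (star_graph n)" "n \<ge> 1"
  shows "\<exists>c\<in>verts G. edges G = star_edges c (verts G)"
proof -
  interpret graph G by fact
  obtain hom where hom: "digraph_isomorphism hom" and star: "star_graph n = app_iso hom G"
    using assms(2) unfolding digraph_iso_def by blast
  have inj: "inj_on (iso_verts hom) (verts G)"
    using hom by (rule digraph_isomorphism_inj_on_verts)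
  have verts: "verts (star_graph n) = iso_verts hom ` verts G"
    by (simp add: star)
  have "0 \<in> iso_verts hom ` verts G"
    using assms(3) by (simp flip: verts add: star_graph_def)
  then obtain c where c: "c \<in> verts G" "iso_verts hom c = 0"
    by auto
  have "(`) (iso_verts hom) ` edges G = (`) (iso_verts hom) ` star_edges c (verts G)"
    using edges_star_graph[OF assms(3)] edges_app_iso[OF hom] image_star_edges[OF inj c(1)]
    by (simp add: star c(2))
  moreover have "edges G \<subseteq> Pow (verts G)" "star_edges c (verts G) \<subseteq> Pow (verts G)"
    using c(1) by (auto simp: edges_def star_edges_def)
  ultimately have "edges G = star_edges c (verts G)"
    by (simp only: inj_on_image_eq_iff[OF inj_on_image_Pow[OF inj]])
  then show ?thesis using c(1) by blast
qed

text \<open>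
  Any bijection of the vertices that sends the centre to 0 gives an isomorphism: an arc goes to the
  pair of the images of its ends, and this is injective because there are no parallel arcs.
\<close>

lemma digraph_iso_if_star_edges:
  assumes "graph G" "card (verts G) = n" "c \<in> verts G" "edges G = star_edges c (verts G)"
  shows "digraph_iso G (star_graph n)"
proof -
  interpret graph G by fact
  have "n \<ge> 1"
    using assms(2,3) by (metis One_nat_def Suc_leI card_gt_0_iff empty_iff finite_verts)
  have "card (verts G - {c}) = card {1..<n}"
    using assms(2,3) by simp
  then obtain g where g: "bij_betw g (verts G - {c}) {1..<n}"
    using finite_same_card_bij by (metis finite_Diff finite_atLeastLessThan finite_verts)
  define h where "h = g(c := 0)"
  have h_c: "h c = 0"
    by (simp add: h_def)
  have h_leaf: "bij_betw h (verts G - {c}) {1..<n}"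
    using g by (rule bij_betw_cong[THEN iffD1, rotated]) (simp add: h_def)
  have "bij_betw h (verts G - {c} \<union> {c}) ({1..<n} \<union> {h c})"
    using h_leaf by (rule notIn_Un_bij_betw[rotated 2]) (simp_all add: h_c)
  moreover have "{1..<n} \<union> {h c} = {0..<n}"
    using \<open>n \<ge> 1\<close> h_c by auto
  ultimately have h: "bij_betw h (verts G) {0..<n}"
    using assms(3) by (simp add: insert_absorb)
  define hom where "hom = \<lparr>iso_verts = h, iso_arcs = (\<lambda>a. (h (tail G a), h (head G a))),
    iso_head = snd, iso_tail = fst\<rparr>"
  have "inj_on (iso_arcs hom) (arcs G)"
  proof (rule inj_onI)
    fix a b assume ab: "a \<in> arcs G" "b \<in> arcs G" "iso_arcs hom a = iso_arcs hom b"
    then have "tail G a = tail G b" "head G a = head G b"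
      using h by (auto simp: hom_def bij_betw_def dest: inj_onD)
    then show "a = b"
      using ab no_multi_arcs by (simp add: arc_to_ends_def)
  qed
  then have "digraph_isomorphism hom"
    using h wf_digraph by (simp add: digraph_isomorphism_def hom_def bij_betw_def)
  moreover have "star_graph n = app_iso hom G"
  proof -
    have ends: "arcs_ends G = {c} \<times> (verts G - {c}) \<union> (verts G - {c}) \<times> {c}"
    proof -
      have "(u, v) \<in> arcs_ends G \<longleftrightarrow> {u, v} \<in> star_edges c (verts G)" for u v
        using edge_iff_arcs_ends[OF sym_arcs] assms(4) by simp
      then show ?thesis
        unfolding star_edges_def by (auto simp: doubleton_eq_iff)
    qed
    have "iso_arcs hom ` arcs G = map_prod h h ` arcs_ends G"
      by (simp add: arcs_ends_conv image_image hom_def)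
    also have "\<dots> = {h c} \<times> h ` (verts G - {c}) \<union> h ` (verts G - {c}) \<times> {h c}"
      unfolding ends image_Un by auto
    also have "\<dots> = {0} \<times> {1..<n} \<union> {1..<n} \<times> {0}"
      by (simp only: h_c bij_betw_imp_surj_on[OF h_leaf])
    finally show ?thesis
      using h by (simp add: star_graph_def app_iso_def with_proj_def hom_def bij_betw_def)
  qed
  ultimately show ?thesis
    unfolding digraph_iso_def by blast
qed

lemma digraph_iso_star_graph_iff:
  assumes "graph G" "card (verts G) = n" "n \<ge> 1"
  shows "digraph_iso G (star_graph n) \<longleftrightarrow> (\<exists>c\<in>verts G. edges G = star_edges c (verts G))"
proof
  show "\<exists>c\<in>verts G. edges G = star_edges c (verts G)" if "digraph_iso G (star_graph n)"
    using assms(1) that assms(3) by (rule star_edges_if_digraph_iso)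
  show "digraph_iso G (star_graph n)" if "\<exists>c\<in>verts G. edges G = star_edges c (verts G)"
    using that digraph_iso_if_star_edges[OF assms(1,2)] by auto
qed

lemma sigma_star_graph:
  assumes "n \<ge> 1"
  shows "sigma 0 (star_graph n) = 2 ^ (n - 1) + 1" "sigma 1 (star_graph n) = n - 1"
proof -
  have "finite (verts (star_graph n))" "0 \<in> verts (star_graph n)" "card (verts (star_graph n)) = n"
    using assms by (simp_all add: star_graph_def)
  then show "sigma 0 (star_graph n) = 2 ^ (n - 1) + 1" "sigma 1 (star_graph n) = n - 1"
    using num_inducing_0_star num_inducing_1_star
    by (metis sigma_eq_num_inducing edges_star_graph[OF assms])+
qed

theorem corollary1:
  fixes T :: "('a, 'b) pre_digraph" and n :: nat
  assumes "undirected_tree T" and "card (verts T) = n"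
  shows "real (sigma 1 T) / real (sigma 0 T)
           \<ge> real (sigma 1 (star_graph n)) / real (sigma 0 (star_graph n))
       \<and> (real (sigma 1 T) / real (sigma 0 T)
            = real (sigma 1 (star_graph n)) / real (sigma 0 (star_graph n))
          \<longleftrightarrow> digraph_iso T (star_graph n))"
proof -
  have T: "graph T" "Digraph_Component.connected T"
    using assms(1) by (simp_all add: undirected_tree_def)
  then interpret connected_edge_family "verts T" "edges T"
    by (rule connected_edge_family_edges)
  have "n \<ge> 1"
    using assms(2) nonempty finite_vertices by (metis One_nat_def Suc_leI card_gt_0_iff)
  then show ?thesis
    using induced_ratio_ge_star induced_ratio_eq_star_iff
    by (simp only: sigma_star_graph digraph_iso_star_graph_iff[OF T(1) assms(2)]
        sigma_eq_num_inducing[of _ T] assms(2))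
qed

end
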